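(* Let $A \in \mathbb{R}^{m \times n}$ with $m \ge n$ have singular value decomposition $A = U\Sigma V^{\rm T} = \sum_{i=1}^n \sigma_i u_i v_i^{\rm T}$, let $0 \le a < b$ and $\Omega := [a,b]$, and let $t$ be the number of indices $i \in \{1,\dots,n\}$ with $\sigma_i \in \Omega$. Let $L, M$ be positive integers and let $V_{\rm in} \in \mathbb{R}^{n \times L}$. Let $\Gamma \subset \mathbb{C}$ be a positively oriented Jordan curve around $[a^2,b^2]$, such that $zI - A^{\rm T}A$ is nonsingular for every $z \in \Gamma$ and such that the eigenvalues of $A^{\rm T}A$ enclosed by $\Gamma$ are exactly those lying in $[a^2,b^2]$. Define $S \in \mathbb{R}^{n \times LM}$ and $S_k \in \mathbb{R}^{n \times L}$ by $$S := [S_0, S_1, \dots, S_{M-1}], \qquad S_k := \frac{1}{2\pi \mathrm{i}} \oint_\Gamma z^k (zI - A^{\rm T}A)^{-1} V_{\rm in}\, \mathrm{d}z .$$ Then $$\mathcal{R}(AS) = \mathrm{span}\{u_i \mid \sigma_i \in \Omega\} \quad\text{and}\quad \mathcal{R}(S) = \mathrm{span}\{v_i \mid \sigma_i \in \Omega\}$$ if and only if $\mathrm{rank}(S) = t$.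
   Context: The singular value decomposition is the thin one: $\Sigma = \mathrm{diag}(\sigma_1,\dots,\sigma_n)$ with singular values $\sigma_i \ge 0$; $U = [u_1,\dots,u_n] \in \mathbb{R}^{m\times n}$ and $V = [v_1,\dots,v_n] \in \mathbb{R}^{n \times n}$ have orthonormal columns, the left and right singular vectors respectively. $\mathcal{R}(X)$ denotes the range (column space) of a matrix $X$. Singular values are counted with multiplicity. The integral of a matrix-valued function is taken entrywise, and $\mathrm{i}$ is the imaginary unit in the prefactor $1/(2\pi\mathrm{i})$.
   Formalization: The formal theorem adds the assumption that no singular value lying in Ω is zero; without it the claim fails, e.g. for A = 0 with m = n = L = M = 1, Ω = [0,1], V_in = 1, where rank(S) = 1 = t but R(AS) = {0}. *)

theory Defs
  imports "HOL-Complex_Analysis.Winding_Numbers"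
begin

definition orthonormal_columns :: "real^'n^'m \<Rightarrow> bool" where
  "orthonormal_columns X \<longleftrightarrow>
     (\<forall>i j. column i X \<bullet> column j X = (if i = j then 1 else 0))"

definition diag_matrix :: "('n \<Rightarrow> real) \<Rightarrow> real^'n^'n" where
  "diag_matrix d = (\<chi> i j. if i = j then d i else 0)"

(* The index type 'n carries no order, so the singular values are a family with repetitions
   (multiplicity), not a sorted list. *)
definition thin_svd ::
    "real^'n^'m \<Rightarrow> real^'n^'m \<Rightarrow> ('n \<Rightarrow> real) \<Rightarrow> real^'n^'n \<Rightarrow> bool" where
  "thin_svd A U \<sigma> V \<longleftrightarrow>
     orthonormal_columns U \<and> orthonormal_columns V \<and> (\<forall>i. 0 \<le> \<sigma> i) \<and>
     A = U ** diag_matrix \<sigma> ** transpose V"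

definition matrix_range :: "real^'n^'m \<Rightarrow> (real^'m) set" where
  "matrix_range X = range (\<lambda>x. X *v x)"

abbreviation cmat :: "real^'n^'m \<Rightarrow> complex^'n^'m" where
  "cmat \<equiv> map_matrix complex_of_real"

definition gram :: "real^'n^'m \<Rightarrow> real^'n^'n" where
  "gram A = transpose A ** A"

definition eigenvalues :: "complex^'n^'n \<Rightarrow> complex set" where
  "eigenvalues B = {l. \<exists>x. x \<noteq> 0 \<and> B *v x = l *s x}"

(* A Jordan curve is a simple closed path; valid_path (piecewise C1) is what makes contour
   integrals along it meaningful. By the Jordan curve theorem the winding number is constantly
   1 or constantly -1 on the inside. *)
definition positive_jordan_curve :: "(real \<Rightarrow> complex) \<Rightarrow> bool" where
  "positive_jordan_curve \<gamma> \<longleftrightarrow>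
     valid_path \<gamma> \<and> simple_path \<gamma> \<and> pathfinish \<gamma> = pathstart \<gamma> \<and>
     (\<forall>w \<in> inside (path_image \<gamma>). winding_number \<gamma> w = 1)"

(* mat z is z times the identity matrix. *)
definition moment ::
    "(real \<Rightarrow> complex) \<Rightarrow> real^'n^'m \<Rightarrow> real^'l^'n \<Rightarrow> nat \<Rightarrow> complex^'l^'n" where
  "moment \<gamma> A V_in k = (\<chi> i j. 1 / (2 * of_real pi * \<i>) *
     contour_integral \<gamma> (\<lambda>z. z ^ k * (matrix_inv (mat z - cmat (gram A)) ** cmat V_in) $ i $ j))"

(* The block row [S_0, ..., S_{M-1}]. Its columns are indexed by 'k \<times> 'l, where 'k is any type
   whose elements idx numbers as 0, ..., M-1; column (q, j) is column j of block number idx q. *)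
definition moment_blocks ::
    "(real \<Rightarrow> complex) \<Rightarrow> real^'n^'m \<Rightarrow> real^'l^'n \<Rightarrow> ('k::finite \<Rightarrow> nat) \<Rightarrow> complex^('k \<times> 'l)^'n" where
  "moment_blocks \<gamma> A V_in idx = (\<chi> i c. moment \<gamma> A V_in (idx (fst c)) $ i $ snd c)"

(* The same matrix as a real one. That Re loses nothing is not evident from the definition,
   because the curve need not be symmetric about the real axis. *)
definition moment_matrix ::
    "(real \<Rightarrow> complex) \<Rightarrow> real^'n^'m \<Rightarrow> real^'l^'n \<Rightarrow> ('k::finite \<Rightarrow> nat) \<Rightarrow> real^('k \<times> 'l)^'n" where
  "moment_matrix \<gamma> A V_in idx = map_matrix Re (moment_blocks \<gamma> A V_in idx)"

end

theory Submission
  imports Defs "HOL-Complex_Analysis.Cauchy_Integral_Formula"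
begin

text \<open>
  Write \<open>l\<^sub>p = \<sigma>\<^sub>p\<^sup>2\<close>. Since \<open>V\<close> is orthogonal, the singular value decomposition diagonalises the
  Gram matrix, \<open>A\<^sup>T A = V diag(l) V\<^sup>T\<close>, and functions of \<open>A\<^sup>T A\<close> are the matrices
  \<open>f(A\<^sup>T A) = V diag(f) V\<^sup>T\<close>; they form an algebra under pointwise operations on \<open>f\<close>
  (\<open>spectral_matrix_mult\<close>). In particular the resolvent at \<open>z\<close> is the function \<open>1 / (z - l\<^sub>p)\<close>, so every
  entry of the integrand is a linear combination of the scalar functions \<open>z\<^sup>k / (z - l\<^sub>p)\<close>, and
  Cauchy's integral formula evaluates their integrals. The winding number of the curve around
  \<open>l\<^sub>p\<close> is 1 or 0, and it is 1 exactly for the indices \<open>p\<close> with \<open>\<sigma>\<^sub>p \<in> [a, b]\<close>. Hence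
  \<open>S\<^sub>k = (\<Sum>p\<in>I. l\<^sub>p\<^sup>k v\<^sub>p v\<^sub>p\<^sup>T) V_in\<close> where \<open>I\<close> is the set of these indices
  (\<open>moment_eq_spectral_matrix\<close>). This is a real matrix, although the curve may be asymmetric.

  The formula shows that the range of \<open>S\<close> always lies in the span of the right singular vectors
  \<open>v\<^sub>p\<close> with \<open>p \<in> I\<close>. These are orthonormal, so the span has dimension \<open>t\<close>, and equality is
  equivalent to \<open>rank S = t\<close>. The statement about \<open>A S\<close> comes for free: \<open>A\<close> maps \<open>v\<^sub>p\<close> to
  \<open>\<sigma>\<^sub>p u\<^sub>p\<close>, and \<open>\<sigma>\<^sub>p\<close> is nonzero for \<open>p \<in> I\<close>, so it maps the one span onto the other
  (\<open>thin_svd_image_span\<close>).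
\<close>

section \<open>Spectral functions of a symmetric matrix\<close>

text \<open>
  For orthogonal \<open>V\<close> this is \<open>V diag(f) V\<^sup>T\<close>, the functional calculus of any symmetric matrix with
  eigenvector basis \<open>V\<close>. The basis is real while the values of \<open>f\<close> live in an arbitrary real
  field, so that the same notation covers \<open>A\<^sup>T A\<close> itself and its complex resolvent.
\<close>

definition spectral_matrix :: "real^'n^'n \<Rightarrow> ('n \<Rightarrow> 'a) \<Rightarrow> 'a::real_field^'n^'n" where
  "spectral_matrix V f = (\<chi> i j. \<Sum>p\<in>UNIV. of_real (V$i$p) * f p * of_real (V$j$p))"

lemma orthonormal_columns_entries:
  fixes V :: "real^'n^'m"
  assumes "orthonormal_columns V"
  shows "(\<Sum>i\<in>UNIV. V$i$p * V$i$q) = (if p = q then 1 else 0)"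
  using assms by (auto simp: orthonormal_columns_def inner_vec_def column_def)

text \<open>
  For a square matrix the left inverse \<open>V\<^sup>T\<close> is also a right inverse. This completeness of the
  basis is what makes the constant function \<open>c\<close> correspond to \<open>c I\<close>.
\<close>

lemma orthonormal_columns_imp_rows:
  fixes V :: "real^'n^'n"
  assumes "orthonormal_columns V"
  shows "(\<Sum>p\<in>UNIV. V$i$p * V$j$p) = (if i = j then 1 else 0)"
proof -
  have "transpose V ** V = mat 1"
    using orthonormal_columns_entries[OF assms]
    by (simp add: matrix_matrix_mult_def transpose_def mat_def vec_eq_iff)
  then have "V ** transpose V = mat 1"
    by (simp add: matrix_left_right_inverse)
  then show ?thesis
    by (simp add: matrix_matrix_mult_def transpose_def mat_def vec_eq_iff)
qed

lemma spectral_matrix_const: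
  assumes "orthonormal_columns V"
  shows "spectral_matrix V (\<lambda>_. c) = mat c"
proof -
  have "(\<Sum>p\<in>UNIV. of_real (V$i$p) * c * of_real (V$j$p)) = (if i = j then c else 0)" for i j
  proof -
    have "(\<Sum>p\<in>UNIV. of_real (V$i$p) * c * of_real (V$j$p))
        = c * of_real (\<Sum>p\<in>UNIV. V$i$p * V$j$p)"
      by (simp add: sum_distrib_left mult_ac)
    then show ?thesis
      by (simp add: orthonormal_columns_imp_rows[OF assms])
  qed
  then show ?thesis
    by (simp add: spectral_matrix_def mat_def vec_eq_iff)
qed

lemma spectral_matrix_diff:
  "spectral_matrix V f - spectral_matrix V g = spectral_matrix V (\<lambda>p. f p - g p)"
  by (simp add: spectral_matrix_def vec_eq_iff sum_subtractf algebra_simps)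

lemma spectral_matrix_mult_vec:
  "spectral_matrix V f *v x =
     (\<Sum>p\<in>UNIV. (f p * (\<Sum>j\<in>UNIV. of_real (V$j$p) * x$j)) *s (\<chi> i. of_real (V$i$p)))"
proof -
  have "(\<Sum>j\<in>UNIV. (\<Sum>p\<in>UNIV. of_real (V$i$p) * f p * of_real (V$j$p)) * x$j)
      = (\<Sum>p\<in>UNIV. (f p * (\<Sum>j\<in>UNIV. of_real (V$j$p) * x$j)) * of_real (V$i$p))" for i
    unfolding sum_distrib_left sum_distrib_right
    by (subst sum.swap) (simp add: mult_ac)
  then show ?thesis
    by (simp add: spectral_matrix_def matrix_vector_mult_def vec_eq_iff)
qed

lemma spectral_matrix_eigenvector:
  fixes f :: "'n::finite \<Rightarrow> 'a::real_field"
  assumes "orthonormal_columns V"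
  shows "spectral_matrix V f *v (\<chi> i. of_real (V$i$p)) = f p *s (\<chi> i. of_real (V$i$p))"
proof -
  have inner: "(\<Sum>j\<in>UNIV. of_real (V$j$q) * of_real (V$j$p)) = (of_real (if q = p then 1 else 0) :: 'a)" for q
    unfolding orthonormal_columns_entries[OF assms, symmetric] by simp
  show ?thesis
    by (simp add: spectral_matrix_mult_vec inner if_distrib if_distribR vec_eq_iff cong: if_cong)
qed

text \<open>
  Each column of the right factor is a combination of the \<open>v\<^sub>p\<close>, and these are eigenvectors of
  the left factor.
\<close>

lemma spectral_matrix_mult:
  assumes "orthonormal_columns V"
  shows "spectral_matrix V f ** spectral_matrix V g = spectral_matrix V (\<lambda>p. f p * g p)"
proof -
  have "(spectral_matrix V f ** spectral_matrix V g) $ i $ j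
      = spectral_matrix V (\<lambda>p. f p * g p) $ i $ j" for i j
  proof -
    have "column j (spectral_matrix V g)
        = (\<Sum>p\<in>UNIV. (g p * of_real (V$j$p)) *s (\<chi> i. of_real (V$i$p)))"
      by (simp add: spectral_matrix_def column_def vec_eq_iff mult_ac)
    then have "spectral_matrix V f *v column j (spectral_matrix V g)
        = (\<Sum>p\<in>UNIV. (g p * of_real (V$j$p)) *s (f p *s (\<chi> i. of_real (V$i$p))))"
      by (simp add: vec.linear_sum[OF matrix_vector_mul_linear_gen] vec.scale
          spectral_matrix_eigenvector[OF assms])
    then have "(spectral_matrix V f *v column j (spectral_matrix V g)) $ i
        = spectral_matrix V (\<lambda>p. f p * g p) $ i $ j"
      by (simp add: spectral_matrix_def mult_ac)
    then show ?thesis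
      by (simp add: matrix_matrix_mult_def matrix_vector_mult_def column_def)
  qed
  then show ?thesis
    by (simp add: vec_eq_iff)
qed

lemma cmat_spectral_matrix:
  "cmat (spectral_matrix V f) = spectral_matrix V (\<lambda>p. complex_of_real (f p))"
  by (simp add: spectral_matrix_def vec_eq_iff)

lemma cmat_matrix_mult: "cmat (X ** Y) = cmat X ** cmat Y"
  by (simp add: matrix_matrix_mult_def vec_eq_iff)

lemma matrix_inv_unique:
  fixes A B :: "'a::semiring_1^'n^'n"
  assumes "A ** B = mat 1" "B ** A = mat 1"
  shows "matrix_inv A = B"
proof -
  have "A ** matrix_inv A = mat 1"
    unfolding matrix_inv_def by (rule someI2[of _ B]) (use assms in auto)
  then show ?thesis
    by (metis assms(2) matrix_mul_assoc matrix_mul_lid matrix_mul_rid)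
qed

lemma matrix_inv_spectral_matrix:
  assumes "orthonormal_columns V" and "\<And>p. f p \<noteq> 0"
  shows "matrix_inv (spectral_matrix V f) = spectral_matrix V (\<lambda>p. inverse (f p))"
  by (rule matrix_inv_unique)
    (simp_all add: spectral_matrix_mult spectral_matrix_const assms)

lemma orthonormal_column_nonzero:
  fixes V :: "real^'n^'n"
  assumes "orthonormal_columns V"
  shows "(\<chi> i. of_real (V$i$p)) \<noteq> (0 :: 'a::real_field^'n)"
proof
  assume "(\<chi> i. of_real (V$i$p)) = (0 :: 'a^'n)"
  then have "V$i$p = 0" for i
    by (simp add: vec_eq_iff)
  then show False
    using orthonormal_columns_entries[OF assms, of p p] by simp
qed

text \<open>
  A zero \<open>f p = 0\<close> puts \<open>v\<^sub>p\<close> into the kernel. With \<open>f q = z - l\<^sub>q\<close> this turns invertibility along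
  the curve into the fact that the curve avoids the eigenvalues.
\<close>

lemma invertible_spectral_matrixD:
  fixes f :: "'n::finite \<Rightarrow> 'a::real_field"
  assumes V: "orthonormal_columns V" and inv: "invertible (spectral_matrix V f)"
  shows "f p \<noteq> 0"
proof
  assume "f p = 0"
  then have 0: "spectral_matrix V f *v (\<chi> i. of_real (V$i$p)) = 0"
    by (simp add: spectral_matrix_eigenvector[OF V])
  obtain B where "B ** spectral_matrix V f = mat 1"
    using inv by (auto simp: invertible_def)
  then have "(\<chi> i. of_real (V$i$p)) = B *v (spectral_matrix V f *v (\<chi> i. of_real (V$i$p)))"
    by (simp add: matrix_vector_mul_assoc)
  then show False
    using 0 orthonormal_column_nonzero[OF V, where 'a='a and p=p] by simp
qed

section \<open>The singular value decomposition\<close>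

lemma thin_svd_mult_column:
  assumes "thin_svd A U \<sigma> V"
  shows "A *v column p V = \<sigma> p *\<^sub>R column p U"
proof -
  have V: "orthonormal_columns V" and A: "A = U ** diag_matrix \<sigma> ** transpose V"
    using assms by (auto simp: thin_svd_def)
  have VV: "transpose V *v column p V = axis p 1"
    using orthonormal_columns_entries[OF V]
    by (auto simp: vec_eq_iff axis_def matrix_vector_mult_def transpose_def column_def)
  have D: "diag_matrix \<sigma> *v axis p 1 = \<sigma> p *\<^sub>R axis p 1"
    unfolding matrix_vector_mult_basis
    by (auto simp: column_def diag_matrix_def axis_def vec_eq_iff)
  have "A *v column p V = U *v (diag_matrix \<sigma> *v (transpose V *v column p V))"
    by (simp only: A matrix_vector_mul_assoc matrix_mul_assoc)
  then show ?thesis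
    unfolding VV D matrix_vector_mult_scaleR by (simp only: matrix_vector_mult_basis)
qed

lemma thin_svd_gram:
  assumes "thin_svd A U \<sigma> V"
  shows "gram A = spectral_matrix V (\<lambda>p. (\<sigma> p)\<^sup>2)"
proof -
  have U: "orthonormal_columns U" and A: "A = U ** diag_matrix \<sigma> ** transpose V"
    using assms by (auto simp: thin_svd_def)
  have UU: "transpose U ** U = mat 1"
    using orthonormal_columns_entries[OF U]
    by (simp add: matrix_matrix_mult_def transpose_def mat_def vec_eq_iff)
  have D: "transpose (diag_matrix \<sigma>) ** diag_matrix \<sigma> = diag_matrix (\<lambda>p. (\<sigma> p)\<^sup>2)"
    by (simp add: matrix_matrix_mult_def transpose_def diag_matrix_def vec_eq_iff
        mult_delta_left power2_eq_square)
  have "gram A = V ** transpose (diag_matrix \<sigma>) ** (transpose U ** U) ** diag_matrix \<sigma> ** transpose V"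
    by (simp add: gram_def A matrix_transpose_mul matrix_mul_assoc)
  also have "\<dots> = V ** diag_matrix (\<lambda>p. (\<sigma> p)\<^sup>2) ** transpose V"
    by (simp add: UU D[symmetric] matrix_mul_assoc)
  also have "\<dots> = spectral_matrix V (\<lambda>p. (\<sigma> p)\<^sup>2)"
    by (simp add: spectral_matrix_def matrix_matrix_mult_def transpose_def diag_matrix_def vec_eq_iff
        mult_delta_right)
  finally show ?thesis .
qed

section \<open>The contour integral\<close>

text \<open>
  Expanding the resolvent in the eigenbasis reduces the integral to finitely many scalar
  integrals of \<open>z\<^sup>k / (z - l\<^sub>p)\<close>, to each of which Cauchy's formula applies. Here the curve is
  any closed path off the eigenvalues: each eigenvalue is weighted by its winding number.
\<close>

lemma has_contour_integral_moment_entry: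
  fixes V :: "real^'n^'n" and V_in :: "real^'l^'n"
  assumes V: "orthonormal_columns V"
    and path: "valid_path \<gamma>" "pathfinish \<gamma> = pathstart \<gamma>"
    and off: "\<And>p. complex_of_real (l p) \<notin> path_image \<gamma>"
  shows "((\<lambda>z. z ^ k * (matrix_inv (mat z - spectral_matrix V (\<lambda>p. complex_of_real (l p)))
                        ** cmat V_in) $ i $ j)
    has_contour_integral
      2 * of_real pi * \<i> *
      (spectral_matrix V (\<lambda>p. winding_number \<gamma> (of_real (l p)) * of_real (l p) ^ k)
        ** cmat V_in) $ i $ j) \<gamma>"
proof -
  \<comment> \<open>The entry of \<open>v\<^sub>p v\<^sub>p\<^sup>T V_in\<close>, the part that the eigenvector \<open>v\<^sub>p\<close> contributes.\<close>
  define c where "c p = complex_of_real (V$i$p) * (\<Sum>h\<in>UNIV. of_real (V$h$p) * of_real (V_in$h$j))"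
    for p
  have entry: "(spectral_matrix V f ** cmat V_in) $ i $ j = (\<Sum>p\<in>UNIV. f p * c p)" for f
    unfolding c_def spectral_matrix_def matrix_matrix_mult_def
    by (simp add: sum_distrib_left sum_distrib_right) (subst sum.swap, simp add: mult_ac)
  have hol: "(\<lambda>z::complex. z ^ k) holomorphic_on UNIV"
    by (intro holomorphic_intros)
  have sum: "((\<lambda>z. \<Sum>p\<in>UNIV. z ^ k / (z - of_real (l p)) * c p)
    has_contour_integral
      (\<Sum>p\<in>UNIV. (2 * of_real pi * \<i> * winding_number \<gamma> (of_real (l p)) * of_real (l p) ^ k) * c p)) \<gamma>"
  proof (intro has_contour_integral_sum has_contour_integral_rmul)
    fix p
    show "((\<lambda>z. z ^ k / (z - of_real (l p))) has_contour_integral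
        2 * of_real pi * \<i> * winding_number \<gamma> (of_real (l p)) * of_real (l p) ^ k) \<gamma>"
      using Cauchy_integral_formula_convex_simple[OF convex_UNIV hol _ path(1) _ path(2)] off[of p]
      by (simp add: subset_Diff_insert)
  qed simp
  have integrand: "(\<Sum>p\<in>UNIV. z ^ k / (z - of_real (l p)) * c p)
      = z ^ k * (matrix_inv (mat z - spectral_matrix V (\<lambda>p. complex_of_real (l p)))
                   ** cmat V_in) $ i $ j" if "z \<in> path_image \<gamma>" for z
  proof -
    have "matrix_inv (mat z - spectral_matrix V (\<lambda>p. complex_of_real (l p)))
        = spectral_matrix V (\<lambda>p. inverse (z - of_real (l p)))"
      unfolding spectral_matrix_const[OF V, symmetric] spectral_matrix_diff
      using off that by (intro matrix_inv_spectral_matrix[OF V]) auto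
    then show ?thesis
      by (simp add: entry sum_distrib_left divide_inverse mult_ac)
  qed
  show ?thesis
    using has_contour_integral_eq[OF sum integrand]
    unfolding entry by (simp add: sum_distrib_left mult.assoc)
qed

text \<open>
  For a positive Jordan curve the winding numbers are 1 inside and 0 outside, so the contour
  integral acts as the filter function \<open>l\<^sup>k\<close> cut off to the enclosed eigenvalues. The right-hand
  side is visibly real.
\<close>

lemma moment_eq_spectral_matrix:
  fixes A :: "real^'n^'m" and V_in :: "real^'l^'n"
  assumes svd: "thin_svd A U \<sigma> V" and curve: "positive_jordan_curve \<gamma>"
    and regular: "\<forall>z \<in> path_image \<gamma>. invertible (mat z - cmat (gram A))"
    and I: "\<And>p. complex_of_real ((\<sigma> p)\<^sup>2) \<in> inside (path_image \<gamma>) \<longleftrightarrow> p \<in> I"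
  shows "moment \<gamma> A V_in k =
    cmat (spectral_matrix V (\<lambda>p. if p \<in> I then (\<sigma> p)\<^sup>2 ^ k else 0) ** V_in)"
proof -
  have V: "orthonormal_columns V"
    using svd by (simp add: thin_svd_def)
  have path: "valid_path \<gamma>" "simple_path \<gamma>" "pathfinish \<gamma> = pathstart \<gamma>"
    and wind: "\<And>w. w \<in> inside (path_image \<gamma>) \<Longrightarrow> winding_number \<gamma> w = 1"
    using curve by (auto simp: positive_jordan_curve_def)
  have gram: "cmat (gram A) = spectral_matrix V (\<lambda>p. complex_of_real ((\<sigma> p)\<^sup>2))"
    by (simp add: thin_svd_gram[OF svd] cmat_spectral_matrix)
  have off: "complex_of_real ((\<sigma> p)\<^sup>2) \<notin> path_image \<gamma>" for p
  proof
    assume "complex_of_real ((\<sigma> p)\<^sup>2) \<in> path_image \<gamma>"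
    then have "invertible (spectral_matrix V (\<lambda>q. complex_of_real ((\<sigma> p)\<^sup>2) - of_real ((\<sigma> q)\<^sup>2)))"
      using regular unfolding gram spectral_matrix_const[OF V, symmetric] spectral_matrix_diff
      by blast
    from invertible_spectral_matrixD[OF V this, of p] show False
      by simp
  qed
  have w: "winding_number \<gamma> (of_real ((\<sigma> p)\<^sup>2)) = (if p \<in> I then 1 else 0)" for p
  proof (cases "p \<in> I")
    case True
    then show ?thesis
      using wind I by auto
  next
    case False
    then have "complex_of_real ((\<sigma> p)\<^sup>2) \<in> outside (path_image \<gamma>)"
      using off I inside_Un_outside[of "path_image \<gamma>"] by blast
    then show ?thesis
      using False winding_number_zero_in_outside[OF valid_path_imp_path[OF path(1)] path(3)]
      by simp
  qed
  have fw: "(\<lambda>p. winding_number \<gamma> (of_real ((\<sigma> p)\<^sup>2)) * of_real ((\<sigma> p)\<^sup>2) ^ k)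
      = (\<lambda>p. complex_of_real (if p \<in> I then (\<sigma> p)\<^sup>2 ^ k else 0))"
    unfolding w by auto
  have "moment \<gamma> A V_in k $ i $ j =
    cmat (spectral_matrix V (\<lambda>p. if p \<in> I then (\<sigma> p)\<^sup>2 ^ k else 0) ** V_in) $ i $ j" for i j
    using contour_integral_unique
      [OF has_contour_integral_moment_entry[OF V path(1,3), where l = "\<lambda>p. (\<sigma> p)\<^sup>2",
          OF off, where k = k and V_in = V_in and i = i and j = j]]
    unfolding cmat_matrix_mult cmat_spectral_matrix fw
    by (simp add: moment_def gram del: of_real_power)
  then show ?thesis
    by (simp add: vec_eq_iff)
qed

section \<open>Ranges\<close>

lemma matrix_range_eq_span_columns:
  "matrix_range X = span (columns X)"
proof
  show "matrix_range X \<subseteq> span (columns X)"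
    unfolding matrix_range_def by (auto intro: matrix_vector_mult_in_columnspace)
  show "span (columns X) \<subseteq> matrix_range X"
    unfolding columns_image_basis matrix_range_def
    by (simp add: linear_span_image[OF matrix_vector_mul_linear] image_mono)
qed

lemma dim_span_orthonormal_columns:
  fixes V :: "real^'n^'m"
  assumes "orthonormal_columns V"
  shows "dim (span {column i V | i. i \<in> I}) = card I"
proof -
  have inner: "column i V \<bullet> column j V = (if i = j then 1 else 0)" for i j
    using assms by (simp add: orthonormal_columns_def)
  have inj: "inj (\<lambda>i. column i V)"
    by (rule injI) (metis inner zero_neq_one)
  have "independent ((\<lambda>i. column i V) ` I)"
  proof (rule pairwise_orthogonal_independent)
    show "pairwise orthogonal ((\<lambda>i. column i V) ` I)"
      by (auto simp: pairwise_def orthogonal_def inner)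
    show "0 \<notin> (\<lambda>i. column i V) ` I"
      by (metis (no_types, lifting) imageE inner inner_zero_left zero_neq_one)
  qed
  then have "dim ((\<lambda>i. column i V) ` I) = card I"
    by (simp add: dim_eq_card_independent card_image inj_on_subset[OF inj])
  then show ?thesis
    by (simp add: image_def Collect_conj_eq setcompr_eq_image dim_span)
qed

text \<open>
  A spectral function vanishing off \<open>I\<close> has its range in the span of the \<open>v\<^sub>p\<close> with \<open>p \<in> I\<close>. The
  function may vary with the column, because the blocks \<open>S\<^sub>k\<close> use the different powers \<open>l\<^sup>k\<close>.
\<close>

lemma matrix_range_subset_of_spectral_columns:
  fixes V_in :: "real^'l^'n"
  assumes col: "\<And>c. column c S =
      spectral_matrix V (\<lambda>p. if p \<in> I then f c p else (0::real)) *v x c"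
  shows "matrix_range S \<subseteq> span {column i V | i. i \<in> I}"
proof -
  have "column c S \<in> span {column i V | i. i \<in> I}" for c
    unfolding col spectral_matrix_mult_vec
  proof (intro span_sum)
    fix p
    show "((if p \<in> I then f c p else 0) * (\<Sum>j\<in>UNIV. of_real (V $ j $ p) * x c $ j))
        *s (\<chi> i. of_real (V $ i $ p)) \<in> span {column i V | i. i \<in> I}"
    proof (cases "p \<in> I")
      case True
      moreover have "(\<chi> i. of_real (V $ i $ p)) = column p V"
        by (simp add: column_def)
      ultimately show ?thesis
        unfolding scalar_mult_eq_scaleR by (intro span_mul span_base) auto
    qed (simp add: span_zero)
  qed
  then show ?thesis
    unfolding matrix_range_eq_span_columns
    by (intro span_minimal) (auto simp: columns_def)
qed

lemma matrix_range_mult: "matrix_range (A ** S) = (*v) A ` matrix_range S"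
  by (auto simp: matrix_range_def matrix_vector_mul_assoc[symmetric])

text \<open>
  \<open>A\<close> maps \<open>v\<^sub>i\<close> to \<open>\<sigma>\<^sub>i u\<^sub>i\<close>. A selected index with \<open>\<sigma>\<^sub>i = 0\<close> would lose the direction \<open>u\<^sub>i\<close>, whence
  the condition on the singular values.
\<close>

lemma thin_svd_image_span:
  assumes svd: "thin_svd A U \<sigma> V" and nonzero: "\<And>i. i \<in> I \<Longrightarrow> \<sigma> i \<noteq> 0"
  shows "(*v) A ` span {column i V | i. i \<in> I} = span {column i U | i. i \<in> I}"
proof -
  have "(*v) A ` span {column i V | i. i \<in> I} = span ((\<lambda>i. \<sigma> i *\<^sub>R column i U) ` I)"
    unfolding setcompr_eq_image
    by (simp add: linear_span_image[OF matrix_vector_mul_linear, symmetric] image_image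
        thin_svd_mult_column[OF svd])
  also have "\<dots> = span ((\<lambda>i. column i U) ` I)"
  proof -
    have "\<sigma> i *\<^sub>R column i U \<in> span ((\<lambda>i. column i U) ` I)" if "i \<in> I" for i
      using that by (intro span_mul span_base) simp
    moreover have "column i U \<in> span ((\<lambda>i. \<sigma> i *\<^sub>R column i U) ` I)" if "i \<in> I" for i
    proof -
      have "inverse (\<sigma> i) *\<^sub>R \<sigma> i *\<^sub>R column i U \<in> span ((\<lambda>i. \<sigma> i *\<^sub>R column i U) ` I)"
        using that by (intro span_mul span_base) simp
      then show ?thesis
        using nonzero[OF that] by simp
    qed
    ultimately show ?thesis
      unfolding span_eq by blast
  qed
  finally show ?thesis
    by (simp add: setcompr_eq_image)
qed

theorem theorem2:
  fixes A U :: "real^'n^'m" and V :: "real^'n^'n" and \<sigma> :: "'n \<Rightarrow> real"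
    and V_in :: "real^'l^'n"
    and a b :: real and \<Gamma> :: "real \<Rightarrow> complex"
    and M t :: nat and idx :: "'k::finite \<Rightarrow> nat"
    and S :: "real^('k \<times> 'l)^'n"
  assumes dims: "CARD('n) \<le> CARD('m)"
    and svd: "thin_svd A U \<sigma> V"
    and interval: "0 \<le> a" "a < b"
    and nonzero: "\<forall>i. \<sigma> i \<in> {a..b} \<longrightarrow> \<sigma> i \<noteq> 0"
    and t: "t = card {i. \<sigma> i \<in> {a..b}}"
    and M: "0 < M" and idx: "bij_betw idx UNIV {0..<M}"
    and curve: "positive_jordan_curve \<Gamma>"
    and around: "complex_of_real ` {a\<^sup>2..b\<^sup>2} \<subseteq> inside (path_image \<Gamma>)"
    and regular: "\<forall>z \<in> path_image \<Gamma>. invertible (mat z - cmat (gram A))"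
    and enclosed: "eigenvalues (cmat (gram A)) \<inter> inside (path_image \<Gamma>) =
                   eigenvalues (cmat (gram A)) \<inter> complex_of_real ` {a\<^sup>2..b\<^sup>2}"
    and S: "S = moment_matrix \<Gamma> A V_in idx"
  shows "cmat S = moment_blocks \<Gamma> A V_in idx \<and>
         (matrix_range (A ** S) = span {column i U | i. \<sigma> i \<in> {a..b}} \<and>
          matrix_range S = span {column i V | i. \<sigma> i \<in> {a..b}}
          \<longleftrightarrow> rank S = t)"
proof -
  define I where "I = {i. \<sigma> i \<in> {a..b}}"
  have V: "orthonormal_columns V" and pos: "\<And>i. 0 \<le> \<sigma> i"
    using svd by (auto simp: thin_svd_def)
  have "complex_of_real ((\<sigma> p)\<^sup>2) \<in> eigenvalues (cmat (gram A))" for p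
    using spectral_matrix_eigenvector[OF V] orthonormal_column_nonzero[OF V]
    unfolding eigenvalues_def thin_svd_gram[OF svd] cmat_spectral_matrix by blast
  then have "complex_of_real ((\<sigma> p)\<^sup>2) \<in> inside (path_image \<Gamma>)
      \<longleftrightarrow> complex_of_real ((\<sigma> p)\<^sup>2) \<in> complex_of_real ` {a\<^sup>2..b\<^sup>2}" for p
    using enclosed by blast
  moreover have "complex_of_real ((\<sigma> p)\<^sup>2) \<in> complex_of_real ` {a\<^sup>2..b\<^sup>2} \<longleftrightarrow> p \<in> I" for p
    using pos[of p] interval
    by (auto simp: I_def power2_le_iff_abs_le abs_le_square_iff[symmetric] image_iff simp del: of_real_power)
  ultimately have moment: "moment \<Gamma> A V_in k =
      cmat (spectral_matrix V (\<lambda>p. if p \<in> I then (\<sigma> p)\<^sup>2 ^ k else 0) ** V_in)" for k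
    using moment_eq_spectral_matrix[OF svd curve regular, of I] by (simp del: of_real_power)
  have real: "cmat S = moment_blocks \<Gamma> A V_in idx"
    by (simp add: S moment_matrix_def moment_blocks_def moment vec_eq_iff)
  have "column c S = spectral_matrix V (\<lambda>p. if p \<in> I then (\<sigma> p)\<^sup>2 ^ idx (fst c) else 0)
      *v column (snd c) V_in" for c
    by (simp add: S moment_matrix_def moment_blocks_def moment vec_eq_iff column_def
        matrix_matrix_mult_def matrix_vector_mult_def)
  then have sub: "matrix_range S \<subseteq> span {column i V | i. i \<in> I}"
    by (rule matrix_range_subset_of_spectral_columns)
  have rank: "rank S = dim (matrix_range S)"
    by (simp add: rank_dim_range matrix_range_def)
  have dimV: "dim (span {column i V | i. i \<in> I}) = t"
    unfolding dim_span_orthonormal_columns[OF V] by (simp add: t I_def)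
  have range: "matrix_range S = span {column i V | i. i \<in> I} \<longleftrightarrow> rank S = t"
  proof
    assume "matrix_range S = span {column i V | i. i \<in> I}"
    then show "rank S = t"
      using rank dimV by simp
  next
    assume "rank S = t"
    then show "matrix_range S = span {column i V | i. i \<in> I}"
      using sub rank dimV
      by (intro subspace_dim_equal) (simp_all add: matrix_range_eq_span_columns)
  qed
  have image: "(*v) A ` span {column i V | i. i \<in> I} = span {column i U | i. i \<in> I}"
    using nonzero by (intro thin_svd_image_span[OF svd]) (auto simp: I_def)
  show ?thesis
    using real range image by (auto simp: matrix_range_mult I_def)
qed

end
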